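(* Let $e=2.7182\dots$ be the Euler number. Then $$-e=-3+\cfrac{-1}{-4+\cfrac{-2}{-5+\cfrac{-3}{-6+\ddots}}}.$$ That is, $-e$ has the continued fraction expansion $b_0+\cfrac{a_1}{b_1+\cfrac{a_2}{b_2+\ddots}}$ with $b_n=-(n+3)$ for all $n\ge0$ and $a_n=-n$ for all $n\ge1$.
   Context: For sequences of numbers $(a_n)_{n\ge1}$ and $(b_n)_{n\ge0}$, the $n$-th convergent $A_n/B_n$ of the (generalized) continued fraction $b_0+\cfrac{a_1}{b_1+\cfrac{a_2}{b_2+\ddots}}$ is its truncation at $a_n/b_n$. The sequences $(A_n)$, $(B_n)$ satisfy $A_n=b_nA_{n-1}+a_nA_{n-2}$ and $B_n=b_nB_{n-1}+a_nB_{n-2}$ for $n\ge1$, with $A_{-1}=1$, $A_0=b_0$, $B_{-1}=0$, $B_0=1$. A number $x$ has this continued fraction expansion (equivalently, $x$ equals the continued fraction) if $\lim_{n\to\infty}A_n/B_n=x$. *)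

theory Defs
  imports Complex_Main
begin

text \<open>
  Generalized continued fractions b0 + a1 / (b1 + a2 / (b2 + ...)). The partial numerators
  start at index 1, so the value a 0 is never used.
  The equations at index 1 are the three-term recurrence with the initial
  values A(-1) = 1 and B(-1) = 0 substituted.
\<close>

fun cfrac_num :: "(nat \<Rightarrow> 'a::comm_ring_1) \<Rightarrow> (nat \<Rightarrow> 'a) \<Rightarrow> nat \<Rightarrow> 'a" where
  "cfrac_num a b 0 = b 0"
| "cfrac_num a b (Suc 0) = b 1 * b 0 + a 1 * 1"
| "cfrac_num a b (Suc (Suc n)) =
     b (Suc (Suc n)) * cfrac_num a b (Suc n) + a (Suc (Suc n)) * cfrac_num a b n"

fun cfrac_den :: "(nat \<Rightarrow> 'a::comm_ring_1) \<Rightarrow> (nat \<Rightarrow> 'a) \<Rightarrow> nat \<Rightarrow> 'a" where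
  "cfrac_den a b 0 = 1"
| "cfrac_den a b (Suc 0) = b 1 * 1 + a 1 * 0"
| "cfrac_den a b (Suc (Suc n)) =
     b (Suc (Suc n)) * cfrac_den a b (Suc n) + a (Suc (Suc n)) * cfrac_den a b n"

definition cfrac_convergent :: "(nat \<Rightarrow> 'a::field) \<Rightarrow> (nat \<Rightarrow> 'a) \<Rightarrow> nat \<Rightarrow> 'a" where
  "cfrac_convergent a b n = cfrac_num a b n / cfrac_den a b n"

text \<open>
  Since x / 0 = 0 in HOL, convergence of the quotients alone would admit sequences
  whose convergents are undefined; the first conjunct excludes this.
\<close>

definition has_cfrac_expansion ::
    "'a::real_normed_field \<Rightarrow> (nat \<Rightarrow> 'a) \<Rightarrow> (nat \<Rightarrow> 'a) \<Rightarrow> bool" where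
  "has_cfrac_expansion x a b \<longleftrightarrow>
     (\<forall>\<^sub>F n in sequentially. cfrac_den a b n \<noteq> 0) \<and> cfrac_convergent a b \<longlonglongrightarrow> x"

end

theory Submission
  imports Defs
begin

text \<open>
  Numerators and denominators both solve \<open>x n = - (n + 3) x (n - 1) - n x (n - 2)\<close>. The first few
  denominators \<open>1, -4, 18, -96, 600\<close> are, up to sign, \<open>(n + 1) (n + 1)!\<close>, and the first few
  convergents \<open>-3, -11/4, -49/18\<close> are close to \<open>- s (n + 1)\<close>, where
  \<open>s n = 1/0! + \<dots> + 1/n!\<close> is the partial sum of the series for \<open>e\<close>. Both
  observations can be made exact: the \<open>n\<close>-th convergent is
  \<open>- s (n + 1) - 1 / ((n + 1) (n + 1)!)\<close>.
  The correction term tends to \<open>0\<close>, so the convergents tend to \<open>- e\<close>; the denominators never vanish.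
  Each closed form (lemmas \<open>cfrac_den_closed_form\<close> and \<open>cfrac_num_closed_form\<close>) is checked against
  the recurrence by induction.
\<close>

lemma cfrac_den_closed_form:
  "cfrac_den (\<lambda>n. - real n) (\<lambda>n. - (real n + 3)) n = (-1) ^ n * (real n + 1) * fact (Suc n)"
proof (induction n rule: induct_nat_012)
  case (ge2 n)
  show ?case
    unfolding cfrac_den.simps ge2 by (simp add: algebra_simps)
qed simp_all

text \<open>
  The part of the numerator proportional to \<open>s (n + 1)\<close> carries the denominator as its coefficient.
  The summand \<open>1\<close> makes up for the fact that the partial sum itself changes with \<open>n\<close>: expressing
  \<open>s (n + 2)\<close> and \<open>s (n + 3)\<close> through \<open>s (n + 1)\<close>, the coefficients of \<open>s (n + 1)\<close> cancel because
  the denominators satisfy the recurrence, and what remains is an identity free of factorials.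
\<close>

lemma cfrac_num_closed_form:
  "cfrac_num (\<lambda>n. - real n) (\<lambda>n. - (real n + 3)) n =
     - ((-1) ^ n) * ((real n + 1) * fact (Suc n) * (\<Sum>k\<le>Suc n. 1 / fact k) + 1)"
proof (induction n rule: induct_nat_012)
  case (ge2 n)
  define f :: real where "f = fact (Suc n)"
  define S :: real where "S = (\<Sum>k\<le>Suc n. 1 / fact k)"
  have f_nz: "f \<noteq> 0"
    by (simp add: f_def)
  have fact2: "fact (Suc (Suc n)) = (real n + 2) * f"
    and fact3: "fact (Suc (Suc (Suc n))) = (real n + 3) * (real n + 2) * f"
    by (simp_all add: f_def algebra_simps)
  have sum2: "(\<Sum>k\<le>Suc (Suc n). 1 / fact k) = S + 1 / ((real n + 2) * f)"
    by (simp only: sum.atMost_Suc[of _ "Suc n"] S_def[symmetric] fact2)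
  have sum3: "(\<Sum>k\<le>Suc (Suc (Suc n)). 1 / fact k)
      = S + 1 / ((real n + 2) * f) + 1 / ((real n + 3) * (real n + 2) * f)"
    by (simp only: sum.atMost_Suc[of _ "Suc (Suc n)"] sum2 fact3)
  have nz: "real n + 2 \<noteq> 0" "real n + 3 \<noteq> 0"
    by linarith+
  have IH0: "cfrac_num (\<lambda>n. - real n) (\<lambda>n. - (real n + 3)) n
      = - ((-1) ^ n) * ((real n + 1) * f * S + 1)"
    using ge2(1) by (simp only: f_def S_def)
  have "(real n + 2) * ((real n + 2) * f) * (S + 1 / ((real n + 2) * f)) + 1
      = (real n + 2) * (real n + 2) * f * S + real n + 3"
    using nz f_nz by (simp add: distrib_left)
  then have IH1: "cfrac_num (\<lambda>n. - real n) (\<lambda>n. - (real n + 3)) (Suc n)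
      = (-1) ^ n * ((real n + 2) * (real n + 2) * f * S + real n + 3)"
    unfolding ge2(2) sum2 fact2 by (simp add: add.commute)
  have expand: "p * (p * m * g) * (s + 1 / (m * g) + 1 / (p * m * g)) = p * p * m * g * s + p * p + p"
    if "p \<noteq> 0" "m \<noteq> 0" "g \<noteq> 0" for p m g s :: real
    using that by (simp add: distrib_left)
  have "(real n + 3) * ((real n + 3) * (real n + 2) * f)
      * (S + 1 / ((real n + 2) * f) + 1 / ((real n + 3) * (real n + 2) * f)) + 1
      = (real n + 3) * (real n + 3) * (real n + 2) * f * S
        + (real n + 3) * (real n + 3) + real n + 4"
    using expand[OF nz(2,1) f_nz, of S] by simp
  then have "- ((-1) ^ Suc (Suc n)) * ((real (Suc (Suc n)) + 1) * fact (Suc (Suc (Suc n)))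
        * (\<Sum>k\<le>Suc (Suc (Suc n)). 1 / fact k) + 1)
      = - ((-1) ^ n) * ((real n + 3) * (real n + 3) * (real n + 2) * f * S
        + (real n + 3) * (real n + 3) + real n + 4)"
    unfolding sum3 fact3 by (simp add: add.commute)
  moreover have "cfrac_num (\<lambda>n. - real n) (\<lambda>n. - (real n + 3)) (Suc (Suc n))
      = - ((-1) ^ n) * ((real n + 3) * (real n + 3) * (real n + 2) * f * S
        + (real n + 3) * (real n + 3) + real n + 4)"
    unfolding cfrac_num.simps IH0 IH1 by (simp add: algebra_simps)
  ultimately show ?case
    by simp
qed simp_all

lemma cfrac_convergent_closed_form:
  "cfrac_convergent (\<lambda>n. - real n) (\<lambda>n. - (real n + 3)) n =
     - ((\<Sum>k\<le>Suc n. 1 / fact k) + 1 / ((real n + 1) * fact (Suc n)))"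
proof -
  have "- s * (d * x + 1) / (s * d) = - (x + 1 / d)" if "s \<noteq> 0" "d \<noteq> 0" for s d x :: real
    using that by (simp add: field_simps)
  from this[of "(-1) ^ n" "(real n + 1) * fact (Suc n)"] show ?thesis
    unfolding cfrac_convergent_def cfrac_num_closed_form cfrac_den_closed_form
    by (simp add: mult.assoc del: fact_Suc sum.atMost_Suc)
qed

theorem corollary1:
  shows "has_cfrac_expansion (- exp 1 :: real) (\<lambda>n. - real n) (\<lambda>n. - (real n + 3))"
proof -
  have "cfrac_den (\<lambda>n. - real n) (\<lambda>n. - (real n + 3)) n \<noteq> 0" for n
    unfolding cfrac_den_closed_form by (simp del: fact_Suc)
  moreover have "cfrac_convergent (\<lambda>n. - real n) (\<lambda>n. - (real n + 3)) \<longlonglongrightarrow> - exp 1"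
  proof -
    have "(\<lambda>n. \<Sum>k\<le>n. 1 / fact k) \<longlonglongrightarrow> (exp 1 :: real)"
      using exp_converges[of "1::real"] by (simp add: sums_def_le divide_inverse)
    then have sums: "(\<lambda>n. \<Sum>k\<le>Suc n. 1 / fact k) \<longlonglongrightarrow> (exp 1 :: real)"
      by (rule LIMSEQ_Suc)
    have correction: "(\<lambda>n. 1 / ((real n + 1) * fact (Suc n))) \<longlonglongrightarrow> 0"
    proof (rule real_tendsto_sandwich[OF _ _ tendsto_const LIMSEQ_inverse_real_of_nat])
      have "(real n + 1) * 1 \<le> (real n + 1) * fact (Suc n)" for n
        by (intro mult_left_mono fact_ge_1) simp
      then show "\<forall>\<^sub>F n in sequentially.
          1 / ((real n + 1) * fact (Suc n)) \<le> inverse (real (Suc n))"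
        by (intro always_eventually allI)
          (simp add: inverse_eq_divide add.commute frac_le del: fact_Suc)
    qed simp
    show ?thesis
      unfolding cfrac_convergent_closed_form
      using tendsto_minus[OF tendsto_add[OF sums correction]] by simp
  qed
  ultimately show ?thesis
    by (simp add: has_cfrac_expansion_def)
qed

end
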